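(* Let $w=(w_n)_{n\geq 1}$ be a bounded sequence of non-zero scalars and $\mathcal{A}$ a uniformly finitely invariant (u.f.i.) upper Furstenberg family. Then the weighted backward shift $B_w$ is $\mathcal{A}$-hypercyclic on $c_0$ if and only if, for any $p\geq 0$ and $M>0$, there exists some $A\in\mathcal{A}$, $A\subset [p,\infty)$, such that (i) $|w_1 w_2\cdots w_n| \to\infty$ as $n\to\infty$, $n\in A$; (ii) for any $n,m\in A$, $n>m$, $|w_1 w_2\cdots w_{n-m+p}| > M$.
   Context: Let $\mathbb{N}_0=\{0,1,2,\ldots\}$. For $A\subset\mathbb{N}_0$ and $n\geq 0$, $A-n=\{k-n : k\in A, k\geq n\}$. A Furstenberg family is a non-empty family $\mathcal{A}$ of subsets of $\mathbb{N}_0$ that is hereditary upward: $A\in\mathcal{A}$, $B\supset A$ imply $B\in\mathcal{A}$. It is proper if $\varnothing\notin\mathcal{A}$. A Furstenberg family $\mathcal{A}$ is called upper if it is proper and it can be written as $\mathcal{A} = \bigcup_{\delta\in D} \mathcal{A}_{\delta}$ with $\mathcal{A}_{\delta}=\bigcap_{\mu\in I} \mathcal{A}_{\delta,\mu}$ for some families $\mathcal{A}_{\delta,\mu}$ of subsets of $\mathbb{N}_0$ ($\delta\in D,\mu\in I$), where the index set $D$ is arbitrary but $I$ is countable, and such that: (1) each $\mathcal{A}_{\delta,\mu}$ is finitely hereditary upward, that is, for any $A\in \mathcal{A}_{\delta,\mu}$ there is a finite set $F\subset\mathbb{N}_0$ such that $B\supset A\cap F$ implies $B\in\mathcal{A}_{\delta,\mu}$;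 (2) $\mathcal{A}$ is uniformly left-invariant, that is, for any $A\in \mathcal{A}$ there is some $\delta\in D$ such that, for all $n\geq 0$, $A-n\in \mathcal{A}_\delta$. Such an upper Furstenberg family is called uniformly finitely invariant (u.f.i.) if, for any $A\in\mathcal{A}$, there is some $\delta\in D$ such that, for all $n\geq 0$, $A\setminus[0,n]\in\mathcal{A}_\delta$. A continuous map $T:X\to X$ is $\mathcal{A}$-hypercyclic if there exists $x\in X$ such that, for any non-empty open set $U$ in $X$, $\{ n\geq 0 : T^nx\in U\}\in \mathcal{A}$. $c_0=c_0(\mathbb{N}_0)$ is the Banach space of (real or complex) null sequences $(x_n)_{n\ge0}$ with the sup norm, and $B_w((x_n)_{n\geq 0})=(w_{n+1}x_{n+1})_{n\geq 0}$. *)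

theory Defs
  imports "HOL-Analysis.Analysis"
begin

section \<open>Furstenberg families\<close>

definition furstenberg_family :: "nat set set \<Rightarrow> bool" where
  "furstenberg_family \<A> \<longleftrightarrow> \<A> \<noteq> {} \<and> (\<forall>A\<in>\<A>. \<forall>B. A \<subseteq> B \<longrightarrow> B \<in> \<A>)"

definition proper_family :: "nat set set \<Rightarrow> bool" where
  "proper_family \<A> \<longleftrightarrow> {} \<notin> \<A>"

definition left_shift :: "nat set \<Rightarrow> nat \<Rightarrow> nat set" where
  "left_shift A n = {k - n | k. k \<in> A \<and> n \<le> k}"

definition finitely_hereditary_upward :: "nat set set \<Rightarrow> bool" where
  "finitely_hereditary_upward \<B> \<longleftrightarrow>
     (\<forall>A\<in>\<B>. \<exists>F. finite F \<and> (\<forall>B. A \<inter> F \<subseteq> B \<longrightarrow> B \<in> \<B>))"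

definition upper_representation ::
    "nat set set \<Rightarrow> 'd set \<Rightarrow> 'i set \<Rightarrow> ('d \<Rightarrow> 'i \<Rightarrow> nat set set) \<Rightarrow> bool" where
  "upper_representation \<A> D I \<F> \<longleftrightarrow>
     countable I \<and>
     \<A> = (\<Union>\<delta>\<in>D. \<Inter>\<mu>\<in>I. \<F> \<delta> \<mu>) \<and>
     (\<forall>\<delta>\<in>D. \<forall>\<mu>\<in>I. finitely_hereditary_upward (\<F> \<delta> \<mu>)) \<and>
     (\<forall>A\<in>\<A>. \<exists>\<delta>\<in>D. \<forall>n. left_shift A n \<in> (\<Inter>\<mu>\<in>I. \<F> \<delta> \<mu>))"

definition finitely_invariant_representation ::
    "nat set set \<Rightarrow> 'd set \<Rightarrow> 'i set \<Rightarrow> ('d \<Rightarrow> 'i \<Rightarrow> nat set set) \<Rightarrow> bool" where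
  "finitely_invariant_representation \<A> D I \<F> \<longleftrightarrow>
     (\<forall>A\<in>\<A>. \<exists>\<delta>\<in>D. \<forall>n. A - {0..n} \<in> (\<Inter>\<mu>\<in>I. \<F> \<delta> \<mu>))"

text \<open>
  The index sets of a representation are arbitrary, but HOL cannot quantify existentially over
  types. Fixing the index types \<^typ>\<open>nat set set\<close> and \<^typ>\<open>nat\<close> loses nothing:
  see \<open>ufi_upper_furstenberg_familyI\<close> below.
\<close>

definition upper_furstenberg_family :: "nat set set \<Rightarrow> bool" where
  "upper_furstenberg_family \<A> \<longleftrightarrow>
     furstenberg_family \<A> \<and> proper_family \<A> \<and>
     (\<exists>(D :: nat set set set) (I :: nat set) \<F>. upper_representation \<A> D I \<F>)"

definition ufi_upper_furstenberg_family :: "nat set set \<Rightarrow> bool" where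
  "ufi_upper_furstenberg_family \<A> \<longleftrightarrow>
     furstenberg_family \<A> \<and> proper_family \<A> \<and>
     (\<exists>(D :: nat set set set) (I :: nat set) \<F>.
        upper_representation \<A> D I \<F> \<and> finitely_invariant_representation \<A> D I \<F>)"

lemma representation_reindex:
  fixes D :: "'d set" and I :: "'i set" and \<F> :: "'d \<Rightarrow> 'i \<Rightarrow> nat set set"
  assumes "countable I"
  obtains D' :: "nat set set set" and I' :: "nat set" and \<F>' where
    "upper_representation \<A> D I \<F> \<Longrightarrow> upper_representation \<A> D' I' \<F>'"
    "finitely_invariant_representation \<A> D I \<F> \<Longrightarrow>
       finitely_invariant_representation \<A> D' I' \<F>'"
proof -
  define G where "G \<delta> = (\<Inter>\<mu>\<in>I. \<F> \<delta> \<mu>)" for \<delta>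
  define D' where "D' = G ` D"
  define I' where "I' = to_nat_on I ` I"
  define \<F>' where "\<F>' B n = \<F> (inv_into D G B) (inv_into I (to_nat_on I) n)" for B n
  have inj: "inj_on (to_nat_on I) I"
    using assms by (rule inj_on_to_nat_on)
  have inv: "inv_into D G B \<in> D" "G (inv_into D G B) = B" if "B \<in> D'" for B
    using that by (auto simp: D'_def inv_into_into f_inv_into_f)
  have fam: "(\<Inter>\<mu>\<in>I'. \<F>' B \<mu>) = B" if "B \<in> D'" for B
  proof -
    have "(\<Inter>\<mu>\<in>I'. \<F>' B \<mu>) = G (inv_into D G B)"
      unfolding I'_def \<F>'_def G_def using inj by (simp add: image_image inv_into_f_f)
    with inv[OF that] show ?thesis by simp
  qed
  have ex: "(\<exists>\<delta>\<in>D'. \<forall>n. f n \<in> (\<Inter>\<mu>\<in>I'. \<F>' \<delta> \<mu>)) \<longleftrightarrow>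
      (\<exists>\<delta>\<in>D. \<forall>n. f n \<in> (\<Inter>\<mu>\<in>I. \<F> \<delta> \<mu>))" for f :: "nat \<Rightarrow> nat set"
  proof -
    have "(\<exists>\<delta>\<in>D'. \<forall>n. f n \<in> (\<Inter>\<mu>\<in>I'. \<F>' \<delta> \<mu>)) \<longleftrightarrow> (\<exists>\<delta>\<in>D'. \<forall>n. f n \<in> \<delta>)"
      by (rule bex_cong) (use fam in auto)
    also have "\<dots> \<longleftrightarrow> (\<exists>\<delta>\<in>D. \<forall>n. f n \<in> G \<delta>)"
      by (auto simp: D'_def)
    finally show ?thesis
      by (simp add: G_def)
  qed
  have un: "(\<Union>\<delta>\<in>D'. \<Inter>\<mu>\<in>I'. \<F>' \<delta> \<mu>) = (\<Union>\<delta>\<in>D. \<Inter>\<mu>\<in>I. \<F> \<delta> \<mu>)"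
  proof -
    have "(\<Union>\<delta>\<in>D'. \<Inter>\<mu>\<in>I'. \<F>' \<delta> \<mu>) = \<Union>D'"
      using fam by auto
    also have "\<dots> = (\<Union>\<delta>\<in>D. G \<delta>)"
      by (simp add: D'_def)
    finally show ?thesis
      by (simp add: G_def)
  qed
  have I: "inv_into I (to_nat_on I) n \<in> I" if "n \<in> I'" for n
    using that by (auto simp: I'_def inv_into_into)
  have her: "\<forall>\<delta>\<in>D'. \<forall>\<mu>\<in>I'. finitely_hereditary_upward (\<F>' \<delta> \<mu>)"
    if "\<forall>\<delta>\<in>D. \<forall>\<mu>\<in>I. finitely_hereditary_upward (\<F> \<delta> \<mu>)"
    using that inv(1) I by (auto simp: \<F>'_def)
  show thesis
  proof (rule that[of D' I' \<F>'])
    assume r: "upper_representation \<A> D I \<F>"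
    have "countable I'" by simp
    with r her show "upper_representation \<A> D' I' \<F>'"
      unfolding upper_representation_def un ex by blast
  next
    assume "finitely_invariant_representation \<A> D I \<F>"
    then show "finitely_invariant_representation \<A> D' I' \<F>'"
      unfolding finitely_invariant_representation_def ex .
  qed
qed

lemma upper_furstenberg_familyI:
  fixes D :: "'d set" and I :: "'i set"
  assumes "furstenberg_family \<A>" "proper_family \<A>" "upper_representation \<A> D I \<F>"
  shows "upper_furstenberg_family \<A>"
  using assms representation_reindex[of I \<A> D \<F>]
  unfolding upper_furstenberg_family_def upper_representation_def[of \<A> D I \<F>] by metis

lemma ufi_upper_furstenberg_familyI:
  fixes D :: "'d set" and I :: "'i set"
  assumes "furstenberg_family \<A>" "proper_family \<A>" "upper_representation \<A> D I \<F>"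
    "finitely_invariant_representation \<A> D I \<F>"
  shows "ufi_upper_furstenberg_family \<A>"
proof -
  have "countable I"
    using assms(3) by (simp add: upper_representation_def)
  then obtain D' :: "nat set set set" and I' :: "nat set" and \<F>' where
    "upper_representation \<A> D' I' \<F>'" "finitely_invariant_representation \<A> D' I' \<F>'"
    using representation_reindex[of I \<A> D \<F>] assms(3,4) by metis
  with assms(1,2) show ?thesis
    unfolding ufi_upper_furstenberg_family_def by blast
qed

section \<open>Hypercyclicity along a family\<close>

definition family_hypercyclic :: "nat set set \<Rightarrow> 'a topology \<Rightarrow> ('a \<Rightarrow> 'a) \<Rightarrow> bool" where
  "family_hypercyclic \<A> X T \<longleftrightarrow>
     continuous_map X X T \<and>
     (\<exists>x\<in>topspace X. \<forall>U. openin X U \<and> U \<noteq> {} \<longrightarrow> {n. (T ^^ n) x \<in> U} \<in> \<A>)"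

section \<open>The space of null sequences and weighted backward shifts\<close>

text \<open>
  As \<^typ>\<open>nat\<close> is discrete, \<^typ>\<open>nat \<Rightarrow>\<^sub>C 'a\<close> consists of all bounded sequences, with the
  supremum norm.
\<close>

definition c0 :: "(nat \<Rightarrow>\<^sub>C 'a :: real_normed_vector) set" where
  "c0 = {x. apply_bcontfun x \<longlonglongrightarrow> 0}"

lemma in_bcontfun_nat: "f \<in> bcontfun \<longleftrightarrow> bounded (range f)" for f :: "nat \<Rightarrow> 'a::metric_space"
  by (simp add: bcontfun_def continuous_on_discrete)

lemma null_sequence_eq_c0:
  fixes f :: "nat \<Rightarrow> 'a :: real_normed_vector"
  assumes "f \<longlonglongrightarrow> 0"
  obtains x where "x \<in> c0" "apply_bcontfun x = f"
proof -
  have "f \<in> bcontfun"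
    using convergent_imp_bounded[OF assms] by (simp add: in_bcontfun_nat)
  then show thesis
    using that[of "Bcontfun f"] assms by (simp add: c0_def Bcontfun_inverse)
qed

lemma subspace_c0: "subspace (c0 :: (nat \<Rightarrow>\<^sub>C 'a :: real_normed_vector) set)"
  by (auto simp: subspace_def c0_def intro: tendsto_add_zero tendsto_eq_intros)

lemma closed_c0: "closed (c0 :: (nat \<Rightarrow>\<^sub>C 'a :: real_normed_vector) set)"
  unfolding closed_sequential_limits
proof safe
  fix x :: "nat \<Rightarrow> nat \<Rightarrow>\<^sub>C 'a" and l
  assume x: "\<forall>n. x n \<in> c0" and lim: "x \<longlonglongrightarrow> l"
  have "apply_bcontfun l \<longlonglongrightarrow> 0"
  proof (rule swap_uniform_limit')
    show "\<forall>\<^sub>F n in sequentially. (apply_bcontfun (x n) \<longlongrightarrow> 0) sequentially"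
      using x by (simp add: c0_def)
    show "(\<lambda>_. 0 :: 'a) \<longlonglongrightarrow> 0"
      by simp
    show "uniform_limit UNIV (\<lambda>n. apply_bcontfun (x n)) (apply_bcontfun l) sequentially"
      using lim by (rule tendsto_bcontfun_uniform_limit)
  qed auto
  then show "l \<in> c0"
    by (simp add: c0_def)
qed

text \<open>
  The entry \<open>w 0\<close> is never used. If \<^term>\<open>w\<close> is unbounded, the value may be unspecified.
\<close>

definition weighted_backward_shift ::
    "(nat \<Rightarrow> 'a) \<Rightarrow> (nat \<Rightarrow>\<^sub>C 'a) \<Rightarrow> (nat \<Rightarrow>\<^sub>C 'a :: real_normed_field)" where
  "weighted_backward_shift w x = Bcontfun (\<lambda>n. w (n + 1) * apply_bcontfun x (n + 1))"

lemma apply_weighted_backward_shift: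
  fixes w :: "nat \<Rightarrow> 'a :: real_normed_field"
  assumes "bounded (w ` {1..})"
  shows "apply_bcontfun (weighted_backward_shift w x) n = w (n + 1) * apply_bcontfun x (n + 1)"
proof -
  obtain K where K: "\<And>n. n \<ge> 1 \<Longrightarrow> norm (w n) \<le> K"
    using assms by (auto simp: bounded_iff)
  have "norm (w (n + 1) * apply_bcontfun x (n + 1)) \<le> K * norm x" for n
    unfolding norm_mult
    by (intro mult_mono K norm_bounded) (use order_trans[OF norm_ge_zero K[of 1]] in auto)
  then have "(\<lambda>n. w (n + 1) * apply_bcontfun x (n + 1)) \<in> bcontfun"
    unfolding in_bcontfun_nat by (intro boundedI) auto
  then show ?thesis
    by (simp add: weighted_backward_shift_def Bcontfun_inverse)
qed

end

theory Submission
  imports Defs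
begin

text \<open>
  Write \<open>W n = w 1 * \<dots> * w n\<close>. The \<open>n\<close>-th power of the shift \<open>T\<close> is governed by the identity
  \<open>W k * (T ^^ n) x k = W (n + k) * x (n + k)\<close>, so both directions reduce to comparing products of
  weights.

  \<^emph>\<open>Necessity.\<close> Let \<open>x\<close> have an orbit visiting every non-empty open set along a set of the family, and let \<open>A\<close>
  be the set of times at which it is within a small \<open>e\<close> of the indicator of \<open>{0..p}\<close>. For \<open>n\<close> in
  \<open>A\<close>, coordinate 0 gives \<open>norm (W n) * norm (x n) > 1 / 2\<close>, and since \<open>x\<close> is a null sequence,
  \<open>norm (W n)\<close> tends to infinity. For \<open>m < n\<close> in \<open>A\<close>, the coordinate \<open>n + p\<close> of \<open>x\<close> is seen at
  time \<open>n\<close> as coordinate \<open>p\<close>, where the orbit is close to 1, and at time \<open>m\<close> as coordinate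
  \<open>n - m + p > p\<close>, where it is below \<open>e\<close>; the quotient of the two is \<open>W (n - m + p) / W p\<close>, which
  is therefore large (\<open>weights_large_on_return_set\<close>). Finite invariance lets one drop the elements of
  \<open>A\<close> up to \<open>p\<close>.

  \<^emph>\<open>Sufficiency.\<close> A category argument (\<open>family_hypercyclic_of_dense_return_sets\<close>) reduces the claim
  to the following: for every ball \<open>V\<close> around a finitely supported \<open>y\<close> there is a \<open>\<delta>\<close> such that every
  non-empty open set contains an \<open>x\<close> whose return set to \<open>V\<close> lies in the subfamily with index \<open>\<delta>\<close>.
  Such an \<open>x\<close> is found by adding to a finitely supported \<open>u\<close> the preimages of \<open>y\<close> under
  \<open>T ^^ n\<close>, that is, copies of \<open>W i * y i / W (n + i)\<close> placed at position \<open>n + i\<close>, for all \<open>n > N\<close> in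
  a suitable \<open>A'\<close>. The growth of \<open>W\<close> along \<open>A'\<close> makes \<open>x\<close> a null sequence close to \<open>u\<close>, and the lower
  bound on \<open>W (n - m + i)\<close> keeps the copies other than the \<open>m\<close>-th small at time \<open>m\<close>
  (\<open>orbit_returning_along_separated_set\<close>).

  The hypotheses control \<open>W n\<close> and \<open>W (n - m + p)\<close> only, whereas all \<open>W (n + i)\<close> and
  \<open>W (n - m + i)\<close> with \<open>i \<le> p\<close> are needed. As the weights are bounded, \<open>W\<close> can be compared with its
  values further left: a lower bound at \<open>n + p\<close> gives one at each \<open>n + i\<close>. Hence \<open>A'\<close> is taken to be
  \<open>A\<close> shifted left by \<open>p\<close>, which belongs to the family by left invariance and has the same differences
  as \<open>A\<close>. Finally \<open>\<delta>\<close> is chosen by finite invariance from \<open>A'\<close>, before the open set is known: it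
  then serves for all the truncations of \<open>A'\<close> that arise from different \<open>u\<close> and \<open>N\<close>.
\<close>

section \<open>Return sets and the Baire category theorem\<close>

lemma finitely_hereditary_upward_mono:
  assumes "finitely_hereditary_upward \<B>" "A \<in> \<B>" "A \<subseteq> B"
  shows "B \<in> \<B>"
proof -
  obtain F where "\<And>C. A \<inter> F \<subseteq> C \<Longrightarrow> C \<in> \<B>"
    using assms(1,2) unfolding finitely_hereditary_upward_def by blast
  then show ?thesis
    using assms(3) by blast
qed

lemma upper_representation_member:
  assumes "upper_representation \<A> D I \<F>" "\<delta> \<in> D" "A \<in> (\<Inter>\<mu>\<in>I. \<F> \<delta> \<mu>)"
  shows "A \<in> \<A>"
proof -
  have "\<A> = (\<Union>\<delta>\<in>D. \<Inter>\<mu>\<in>I. \<F> \<delta> \<mu>)"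
    using assms(1) by (simp only: upper_representation_def)
  then show ?thesis
    using assms(2,3) by (metis UN_I)
qed

lemma continuous_map_funpow:
  assumes "continuous_map X X T"
  shows "continuous_map X X (T ^^ n)"
proof (induction n)
  case (Suc n)
  then show ?case
    using continuous_map_compose[OF Suc assms] by (simp add: o_def)
qed (simp add: continuous_map_id)

text \<open>
  Membership in a finitely hereditary family is witnessed by finitely many return times, and finitely
  many iterates of a nearby point stay in the open set \<open>V\<close> as well.
\<close>
lemma openin_return_set:
  assumes T: "continuous_map X X T" and V: "openin X V"
    and \<B>: "finitely_hereditary_upward \<B>"
  shows "openin X {x \<in> topspace X. {n. (T ^^ n) x \<in> V} \<in> \<B>}"
proof (subst openin_subopen, clarsimp)
  fix x assume x: "x \<in> topspace X" "{n. (T ^^ n) x \<in> V} \<in> \<B>"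
  then obtain F where F: "finite F" "\<And>B. {n. (T ^^ n) x \<in> V} \<inter> F \<subseteq> B \<Longrightarrow> B \<in> \<B>"
    using \<B> unfolding finitely_hereditary_upward_def by blast
  define J where "J = {n \<in> F. (T ^^ n) x \<in> V}"
  define U where "U = topspace X \<inter> (\<Inter>n\<in>J. {y \<in> topspace X. (T ^^ n) y \<in> V})"
  have "openin X U"
    unfolding U_def
    by (intro openin_Int_Inter openin_topspace)
       (use F(1) in \<open>auto simp: J_def intro!: openin_continuous_map_preimage continuous_map_funpow T V\<close>)
  moreover have "x \<in> U"
    using x(1) by (auto simp: U_def J_def)
  moreover have "{n. (T ^^ n) y \<in> V} \<in> \<B>" if "y \<in> U" for y
    by (rule F(2)) (use that in \<open>auto simp: U_def J_def\<close>)
  ultimately show "\<exists>U. openin X U \<and> x \<in> U \<and> U \<subseteq> {x \<in> topspace X. {n. (T ^^ n) x \<in> V} \<in> \<B>}"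
    by (intro exI[of _ U]) (auto simp: U_def)
qed

text \<open>
  A Birkhoff transitivity theorem for families: for each \<open>V\<close> in a countable collection of test sets and
  each \<open>\<mu>\<close>, the points whose return set to \<open>V\<close> lies in \<open>\<F> \<delta> \<mu>\<close>, with \<open>\<delta>\<close> chosen for \<open>V\<close>, form a dense
  open set. Any point common to these countably many sets has the required orbit. It matters that
  \<open>\<delta>\<close> depends on \<open>V\<close> only: \<open>D\<close> may be uncountable, and the intersection over \<open>\<mu>\<close> must be taken for
  one fixed \<open>\<delta>\<close>.
\<close>
theorem family_hypercyclic_of_dense_return_sets:
  assumes X: "completely_metrizable_space X" "topspace X \<noteq> {}"
    and T: "continuous_map X X T"
    and \<A>: "furstenberg_family \<A>" "upper_representation \<A> D I \<F>"
    and \<V>: "countable \<V>" "\<And>V. V \<in> \<V> \<Longrightarrow> openin X V"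
      "\<And>U. openin X U \<Longrightarrow> U \<noteq> {} \<Longrightarrow> \<exists>V\<in>\<V>. V \<subseteq> U"
    and hit: "\<And>V. V \<in> \<V> \<Longrightarrow> \<exists>\<delta>\<in>D. \<forall>U. openin X U \<and> U \<noteq> {} \<longrightarrow>
      (\<exists>x\<in>U. {n. (T ^^ n) x \<in> V} \<in> (\<Inter>\<mu>\<in>I. \<F> \<delta> \<mu>))"
  shows "family_hypercyclic \<A> X T"
proof -
  obtain d where d: "\<And>V. V \<in> \<V> \<Longrightarrow> d V \<in> D"
    "\<And>V U. V \<in> \<V> \<Longrightarrow> openin X U \<Longrightarrow> U \<noteq> {} \<Longrightarrow>
      \<exists>x\<in>U. {n. (T ^^ n) x \<in> V} \<in> (\<Inter>\<mu>\<in>I. \<F> (d V) \<mu>)"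
    using hit by metis
  define O' where "O' = (\<lambda>(V, \<mu>). {x \<in> topspace X. {n. (T ^^ n) x \<in> V} \<in> \<F> (d V) \<mu>})"
  have I: "countable I" and her: "\<And>\<delta> \<mu>. \<delta> \<in> D \<Longrightarrow> \<mu> \<in> I \<Longrightarrow> finitely_hereditary_upward (\<F> \<delta> \<mu>)"
    using \<A>(2) by (auto simp: upper_representation_def)
  have "X closure_of \<Inter>(O' ` (\<V> \<times> I)) = topspace X"
  proof (rule Baire_category)
    show "completely_metrizable_space X \<or> locally_compact_space X \<and> regular_space X"
      using X(1) by simp
    show "countable (O' ` (\<V> \<times> I))"
      using \<V>(1) I by simp
    fix G assume "G \<in> O' ` (\<V> \<times> I)"
    then obtain V \<mu> where V: "V \<in> \<V>" "\<mu> \<in> I"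
      and G: "G = {x \<in> topspace X. {n. (T ^^ n) x \<in> V} \<in> \<F> (d V) \<mu>}"
      by (auto simp: O'_def)
    have "openin X G"
      unfolding G by (intro openin_return_set T \<V>(2) her d(1) V)
    moreover have "X closure_of G = topspace X"
      unfolding dense_intersects_open
    proof (intro allI impI)
      fix U assume U: "openin X U \<and> U \<noteq> {}"
      then obtain x where "x \<in> U" "{n. (T ^^ n) x \<in> V} \<in> (\<Inter>\<mu>\<in>I. \<F> (d V) \<mu>)"
        using d(2)[OF V(1)] by blast
      then have "x \<in> G \<inter> U"
        using V(2) U openin_subset[of X U] by (auto simp: G)
      then show "G \<inter> U \<noteq> {}"
        by blast
    qed
    ultimately show "openin X G \<and> X closure_of G = topspace X" ..
  qed
  then have "\<Inter>(O' ` (\<V> \<times> I)) \<inter> topspace X \<noteq> {}"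
    using X(2) unfolding dense_intersects_open by blast
  then obtain x where x: "x \<in> topspace X" "\<And>V \<mu>. V \<in> \<V> \<Longrightarrow> \<mu> \<in> I \<Longrightarrow> x \<in> O' (V, \<mu>)"
    by blast
  have "{n. (T ^^ n) x \<in> U} \<in> \<A>" if U: "openin X U" "U \<noteq> {}" for U
  proof -
    obtain V where V: "V \<in> \<V>" "V \<subseteq> U"
      using \<V>(3)[OF U] by blast
    have "{n. (T ^^ n) x \<in> V} \<in> \<F> (d V) \<mu>" if "\<mu> \<in> I" for \<mu>
      using x(2)[OF V(1) that] by (simp add: O'_def)
    then have "{n. (T ^^ n) x \<in> V} \<in> (\<Inter>\<mu>\<in>I. \<F> (d V) \<mu>)"
      by (rule INT_I)
    then have "{n. (T ^^ n) x \<in> V} \<in> \<A>"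
      by (rule upper_representation_member[OF \<A>(2) d(1)[OF V(1)]])
    moreover have "{n. (T ^^ n) x \<in> V} \<subseteq> {n. (T ^^ n) x \<in> U}"
      using V(2) by blast
    ultimately show ?thesis
      using \<A>(1) unfolding furstenberg_family_def by meson
  qed
  then show ?thesis
    unfolding family_hypercyclic_def using T x(1) by blast
qed

section \<open>The topology of the space of null sequences\<close>

text \<open>
  A uniform limit of bounded continuous functions is bounded and continuous, whatever the topology of
  the domain.
\<close>
lemma complete_bcontfun:
  "complete (UNIV :: ('b::topological_space \<Rightarrow>\<^sub>C 'a::complete_space) set)"
proof (rule completeI)
  fix f :: "nat \<Rightarrow> 'b \<Rightarrow>\<^sub>C 'a" assume "Cauchy f"
  then have "uniformly_Cauchy_on UNIV (\<lambda>n. apply_bcontfun (f n))"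
    by (intro uniformly_Cauchy_onI) (metis Cauchy_def dist_fun_lt_imp_dist_val_lt)
  then obtain g where g: "uniform_limit UNIV (\<lambda>n. apply_bcontfun (f n)) g sequentially"
    using Cauchy_uniformly_convergent uniformly_convergent_on_def by blast
  obtain l where "f \<longlonglongrightarrow> l"
    using uniform_limit_bcontfunE[OF g] by auto
  then show "\<exists>l\<in>UNIV. f \<longlonglongrightarrow> l"
    by blast
qed

lemma completely_metrizable_c0:
  "completely_metrizable_space
     (top_of_set (c0 :: (nat \<Rightarrow>\<^sub>C 'a::{real_normed_vector, complete_space}) set))"
proof (rule completely_metrizable_space_closedin)
  show "completely_metrizable_space (euclidean :: (nat \<Rightarrow>\<^sub>C 'a) topology)"
    using Met_TC.completely_metrizable_space_mtopology complete_bcontfun by auto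
  show "closedin euclidean (c0 :: (nat \<Rightarrow>\<^sub>C 'a) set)"
    using closed_c0 by simp
qed

definition fin_seq :: "'a list \<Rightarrow> (nat \<Rightarrow>\<^sub>C 'a::real_normed_vector)" where
  "fin_seq xs = Bcontfun (\<lambda>n. if n < length xs then xs ! n else 0)"

lemma apply_fin_seq: "apply_bcontfun (fin_seq xs) n = (if n < length xs then xs ! n else 0)"
  and fin_seq_in_c0: "fin_seq xs \<in> c0"
proof -
  have "\<forall>\<^sub>F n in sequentially. (if n < length xs then xs ! n else 0) = 0"
    using eventually_ge_at_top[of "length xs"] by eventually_elim simp
  then have "(\<lambda>n. if n < length xs then xs ! n else 0) \<longlonglongrightarrow> 0"
    by (rule tendsto_eventually)
  then obtain x where x: "x \<in> c0" "apply_bcontfun x = (\<lambda>n. if n < length xs then xs ! n else 0)"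
    by (rule null_sequence_eq_c0)
  have "fin_seq xs = x"
    by (simp add: fin_seq_def x(2)[symmetric] apply_bcontfun_inverse)
  then show "apply_bcontfun (fin_seq xs) n = (if n < length xs then xs ! n else 0)" "fin_seq xs \<in> c0"
    using x by simp_all
qed

lemma fin_seq_dense_in_c0:
  fixes x :: "nat \<Rightarrow>\<^sub>C 'a::real_normed_vector"
  assumes x: "x \<in> c0" and r: "0 < r"
    and Q: "\<And>X::'a set. open X \<Longrightarrow> X \<noteq> {} \<Longrightarrow> \<exists>q\<in>Q. q \<in> X"
  obtains xs where "xs \<in> lists Q" "dist x (fin_seq xs) < r"
proof -
  have "\<exists>q\<in>Q. q \<in> ball (apply_bcontfun x n) (r / 2)" for n
    using r by (intro Q) auto
  then obtain q where q: "\<And>n. q n \<in> Q" "\<And>n. dist (apply_bcontfun x n) (q n) < r / 2"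
    unfolding mem_ball by metis
  have "apply_bcontfun x \<longlonglongrightarrow> 0"
    using x by (simp add: c0_def)
  then obtain N where N: "\<And>n. n \<ge> N \<Longrightarrow> dist (apply_bcontfun x n) 0 < r / 2"
    using r unfolding lim_sequentially by (meson half_gt_zero)
  define xs where "xs = map q [0..<N]"
  have "dist (apply_bcontfun x n) (apply_bcontfun (fin_seq xs) n) \<le> r / 2" for n
    using N[of n] q(2)[of n] by (auto simp: apply_fin_seq xs_def)
  then have "dist x (fin_seq xs) \<le> r / 2"
    by (rule dist_bound)
  then have "dist x (fin_seq xs) < r"
    using r by simp
  moreover have "xs \<in> lists Q"
    using q(1) by (auto simp: xs_def)
  ultimately show thesis
    using that by blast
qed

text \<open>
  The test sets for the category argument. Their centres are finitely supported, so that they have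
  preimages under each power of the shift that consist of a single finite block.
\<close>
lemma c0_countable_pi_base:
  obtains \<V> :: "(nat \<Rightarrow>\<^sub>C 'a::{real_normed_vector, second_countable_topology}) set set"
  where "countable \<V>"
    and "\<And>V. V \<in> \<V> \<Longrightarrow> \<exists>ys r. 0 < r \<and> V = c0 \<inter> ball (fin_seq ys) r"
    and "\<And>U. openin (top_of_set c0) U \<Longrightarrow> U \<noteq> {} \<Longrightarrow> \<exists>V\<in>\<V>. V \<subseteq> U"
proof -
  obtain Q :: "'a set" where Q: "countable Q" "\<And>X. open X \<Longrightarrow> X \<noteq> {} \<Longrightarrow> \<exists>q\<in>Q. q \<in> X"
    using countable_dense_setE by blast
  define \<V> where "\<V> = (\<lambda>(ys :: 'a list, j). c0 \<inter> ball (fin_seq ys) (1 / real (Suc j))) ` (lists Q \<times> UNIV)"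
  show thesis
  proof
    show "countable \<V>"
      unfolding \<V>_def using Q(1) by (intro countable_image countable_SIGMA countable_lists) auto
    show "\<exists>ys r. 0 < r \<and> V = c0 \<inter> ball (fin_seq ys) r" if "V \<in> \<V>" for V
      using that unfolding \<V>_def by (force intro: exI[of _ "1 / real (Suc _)"])
    fix U :: "(nat \<Rightarrow>\<^sub>C 'a) set" assume U: "openin (top_of_set c0) U" "U \<noteq> {}"
    then obtain x where x: "x \<in> U" "x \<in> c0"
      using openin_imp_subset by blast
    obtain e where e: "0 < e" "ball x e \<inter> c0 \<subseteq> U"
      using U(1) x(1) unfolding openin_contains_ball by blast
    obtain j where j: "1 / real (Suc j) < e / 2"
      using nat_approx_posE[of "e / 2"] e(1) by auto
    obtain ys where ys: "ys \<in> lists Q" "dist x (fin_seq ys) < 1 / real (Suc j)"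
      using fin_seq_dense_in_c0[OF x(2) _ Q(2), of "1 / real (Suc j)"] by auto
    have "c0 \<inter> ball (fin_seq ys) (1 / real (Suc j)) \<subseteq> U"
    proof
      fix z assume z: "z \<in> c0 \<inter> ball (fin_seq ys) (1 / real (Suc j))"
      then have "dist x z < e"
        using dist_triangle[of x z "fin_seq ys"] ys(2) j by simp
      then show "z \<in> U"
        using e(2) z by auto
    qed
    then show "\<exists>V\<in>\<V>. V \<subseteq> U"
      using ys(1) unfolding \<V>_def by blast
  qed
qed

section \<open>Powers of a weighted backward shift\<close>

locale weight_sequence =
  fixes w :: "nat \<Rightarrow> 'a :: {real_normed_field, euclidean_space}"
  assumes bounded_weights: "bounded (w ` {1..})"
    and nonzero_weights: "\<forall>n\<ge>1. w n \<noteq> 0"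
begin

abbreviation T :: "(nat \<Rightarrow>\<^sub>C 'a) \<Rightarrow> (nat \<Rightarrow>\<^sub>C 'a)" where
  "T \<equiv> weighted_backward_shift w"

definition W :: "nat \<Rightarrow> 'a" where
  "W n = (\<Prod>i=1..n. w i)"

lemma W_0 [simp]: "W 0 = 1"
  and W_Suc: "W (Suc n) = w (Suc n) * W n"
  by (simp_all add: W_def mult.commute)

lemma W_nonzero [simp]: "W n \<noteq> 0"
  using nonzero_weights by (auto simp: W_def)

lemma weight_bound:
  obtains K where "1 \<le> K" "\<And>n. n \<ge> 1 \<Longrightarrow> norm (w n) \<le> K"
proof -
  obtain b where "\<And>n. n \<ge> 1 \<Longrightarrow> norm (w n) \<le> b"
    using bounded_weights by (auto simp: bounded_iff)
  then show thesis
    using that[of "max 1 b"] by (simp add: le_max_iff_disj)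
qed

text \<open>
  Bounded weights prevent \<open>W\<close> from jumping up, so a large value at the right end of a block of length
  \<open>p\<close> forces large values throughout the block. The converse fails, as weights may be close to 0.
\<close>
lemma W_le_within_block:
  obtains C where "0 < C" "\<And>n i. i \<le> p \<Longrightarrow> norm (W (n + p)) \<le> C * norm (W (n + i))"
proof -
  obtain K where K: "1 \<le> K" "\<And>n. n \<ge> 1 \<Longrightarrow> norm (w n) \<le> K"
    using weight_bound by blast
  have step: "norm (W (m + d)) \<le> K ^ d * norm (W m)" for m d
  proof (induction d)
    case (Suc d)
    have "norm (W (m + Suc d)) \<le> K * (K ^ d * norm (W m))"
      using K(1) by (auto simp: W_Suc norm_mult intro!: mult_mono K(2) Suc)
    then show ?case by simp
  qed simp
  have "norm (W (n + p)) \<le> K ^ p * norm (W (n + i))" if "i \<le> p" for n i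
  proof -
    have "norm (W (n + p)) \<le> K ^ (p - i) * norm (W (n + i))"
      using step[of "n + i" "p - i"] that by simp
    also have "\<dots> \<le> K ^ p * norm (W (n + i))"
      using K(1) by (intro mult_right_mono power_increasing) auto
    finally show ?thesis .
  qed
  then show thesis
    using that[of "K ^ p"] K(1) by auto
qed

text \<open>
  Multiplying by \<open>W k\<close> conjugates the weighted shift to the unweighted one, which turns every
  statement on coordinates of orbits into one on values of \<open>W\<close>.
\<close>
lemma W_times_funpow_T:
  "W k * apply_bcontfun ((T ^^ n) x) k = W (n + k) * apply_bcontfun x (n + k)"
proof (induction n arbitrary: x)
  case (Suc n)
  have "W k * apply_bcontfun ((T ^^ Suc n) x) k = W k * apply_bcontfun ((T ^^ n) (T x)) k"
    by (simp add: funpow_swap1)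
  also have "\<dots> = W (n + k) * apply_bcontfun (T x) (n + k)"
    by (rule Suc)
  finally show ?case
    by (simp add: apply_weighted_backward_shift[OF bounded_weights] W_Suc mult_ac)
qed simp

lemma continuous_map_T: "continuous_map (top_of_set c0) (top_of_set c0) T"
proof -
  obtain K where K: "1 \<le> K" "\<And>n. n \<ge> 1 \<Longrightarrow> norm (w n) \<le> K"
    using weight_bound by blast
  note app = apply_weighted_backward_shift[OF bounded_weights]
  have "dist (T x) (T y) \<le> K * dist x y" for x y
  proof (rule dist_bound)
    fix n
    have "dist (apply_bcontfun (T x) n) (apply_bcontfun (T y) n)
        = norm (w (n + 1)) * dist (apply_bcontfun x (n + 1)) (apply_bcontfun y (n + 1))"
      by (simp add: app dist_norm flip: norm_mult right_diff_distrib)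
    also have "\<dots> \<le> K * dist x y"
      using K by (intro mult_mono dist_bounded) auto
    finally show "dist (apply_bcontfun (T x) n) (apply_bcontfun (T y) n) \<le> K * dist x y" .
  qed
  then have "K-lipschitz_on c0 T"
    using K(1) by (intro lipschitz_onI) auto
  then have "continuous_on c0 T"
    by (rule lipschitz_on_continuous_on)
  moreover have "T x \<in> c0" if "x \<in> c0" for x
  proof -
    have "(\<lambda>n. apply_bcontfun x (n + 1)) \<longlonglongrightarrow> 0"
      using that by (intro LIMSEQ_ignore_initial_segment) (simp add: c0_def)
    then have "(\<lambda>n. w (n + 1) * apply_bcontfun x (n + 1)) \<longlonglongrightarrow> 0"
    proof (rule Lim_null_comparison[rotated, OF tendsto_mult_right_zero[OF tendsto_norm_zero, of _ _ K]])
      show "\<forall>\<^sub>F n in sequentially. norm (w (n + 1) * apply_bcontfun x (n + 1))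
          \<le> K * norm (apply_bcontfun x (n + 1))"
        by (auto simp: norm_mult intro!: always_eventually mult_right_mono K(2))
    qed
    then show ?thesis
      by (simp add: c0_def app[abs_def])
  qed
  ultimately show ?thesis
    by auto
qed

section \<open>Necessity\<close>

lemma filterlim_norm_W_iff:
  "filterlim (\<lambda>n. norm (\<Prod>i=1..n. w i)) at_top (inf sequentially (principal A)) \<longleftrightarrow>
    (\<forall>Z. \<exists>N. \<forall>n\<in>A. N \<le> n \<longrightarrow> Z \<le> norm (W n))"
  unfolding filterlim_at_top eventually_inf_principal eventually_sequentially W_def by blast

text \<open>
  The orbit is bounded below on the first coordinates at all times in \<open>A\<close> and small elsewhere. By
  \<open>W_times_funpow_T\<close>, \<open>W (n + p) * x (n + p)\<close> equals both \<open>W p\<close> times a coordinate of the first kind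
  at time \<open>n\<close> and \<open>W (n - m + p)\<close> times a coordinate of the second kind at time \<open>m\<close>.
\<close>
lemma weights_large_on_return_set:
  assumes x: "x \<in> c0"
    and A: "\<And>n k. n \<in> A \<Longrightarrow> k \<le> p \<Longrightarrow> 1 / 2 < norm (apply_bcontfun ((T ^^ n) x) k)"
    and small: "\<And>n k. n \<in> A \<Longrightarrow> p < k \<Longrightarrow> norm (apply_bcontfun ((T ^^ n) x) k) < e"
    and e: "0 < e" "2 * M * e \<le> norm (W p)"
  shows "filterlim (\<lambda>n. norm (\<Prod>i=1..n. w i)) at_top (inf sequentially (principal A))"
    and "\<And>n m. n \<in> A \<Longrightarrow> m \<in> A \<Longrightarrow> m < n \<Longrightarrow> M < norm (W (n - m + p))"
proof -
  show "filterlim (\<lambda>n. norm (\<Prod>i=1..n. w i)) at_top (inf sequentially (principal A))"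
    unfolding filterlim_norm_W_iff
  proof
    fix Z :: real
    have "apply_bcontfun x \<longlonglongrightarrow> 0"
      using x by (simp add: c0_def)
    then obtain N where N: "\<And>n. n \<ge> N \<Longrightarrow> dist (apply_bcontfun x n) 0 < 1 / (2 * max 1 Z)"
      unfolding lim_sequentially
      by (meson less_max_iff_disj zero_less_one zero_less_divide_1_iff zero_less_mult_iff
          zero_less_numeral)
    have "Z \<le> norm (W n)" if n: "n \<in> A" "N \<le> n" for n
    proof (rule ccontr)
      assume "\<not> Z \<le> norm (W n)"
      then have "norm (W n) * norm (apply_bcontfun x n) \<le> max 1 Z * (1 / (2 * max 1 Z))"
        using N[OF n(2)] by (intro mult_mono) auto
      also have "\<dots> = 1 / 2"
        by simp
      also have "\<dots> < norm (W 0 * apply_bcontfun ((T ^^ n) x) 0)"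
        using A[OF n(1), of 0] by simp
      finally show False
        by (simp only: W_times_funpow_T norm_mult add_0_right)
    qed
    then show "\<exists>N. \<forall>n\<in>A. N \<le> n \<longrightarrow> Z \<le> norm (W n)"
      by blast
  qed
  fix n m assume nm: "n \<in> A" "m \<in> A" "m < n"
  have "W (n - m + p) * apply_bcontfun ((T ^^ m) x) (n - m + p)
      = W p * apply_bcontfun ((T ^^ n) x) p"
    using nm(3) by (simp add: W_times_funpow_T)
  then have eq: "norm (W (n - m + p)) * norm (apply_bcontfun ((T ^^ m) x) (n - m + p))
      = norm (W p) * norm (apply_bcontfun ((T ^^ n) x) p)"
    by (simp flip: norm_mult)
  have "e * M \<le> norm (W p) * (1 / 2)"
    using e(2) by (simp add: mult_ac)
  also have "\<dots> < norm (W p) * norm (apply_bcontfun ((T ^^ n) x) p)"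
    using A[OF nm(1), of p] by (intro mult_strict_left_mono) auto
  also have "\<dots> \<le> norm (W (n - m + p)) * e"
    unfolding eq[symmetric] using small[OF nm(2), of "n - m + p"] nm(3)
    by (intro mult_left_mono less_imp_le) auto
  finally show "M < norm (W (n - m + p))"
    using e(1) by (simp add: mult.commute)
qed

lemma large_weights_of_family_hypercyclic:
  assumes \<A>: "\<And>A n. A \<in> \<A> \<Longrightarrow> A - {0..n} \<in> \<A>"
    and hyp: "family_hypercyclic \<A> (top_of_set c0) T" and M: "0 < M"
  shows "\<exists>A\<in>\<A>. A \<subseteq> {p..} \<and>
    filterlim (\<lambda>n. norm (\<Prod>i=1..n. w i)) at_top (inf sequentially (principal A)) \<and>
    (\<forall>n\<in>A. \<forall>m\<in>A. n > m \<longrightarrow> norm (W (n - m + p)) > M)"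
proof -
  obtain x where x: "x \<in> c0"
    "\<And>U. openin (top_of_set c0) U \<Longrightarrow> U \<noteq> {} \<Longrightarrow> {n. (T ^^ n) x \<in> U} \<in> \<A>"
    using hyp by (auto simp: family_hypercyclic_def)
  define y :: "nat \<Rightarrow>\<^sub>C 'a" where "y = fin_seq (replicate (Suc p) 1)"
  \<comment> \<open>the bound 1/2 keeps the orbit away from 0 where \<open>y\<close> is 1; the other one yields \<open>M\<close>\<close>
  define e where "e = min (1 / 2) (norm (W p) / (2 * M))"
  define A where "A = {n. (T ^^ n) x \<in> c0 \<inter> ball y e}"
  have y: "apply_bcontfun y k = (if k \<le> p then 1 else 0)" for k
    by (auto simp: y_def apply_fin_seq simp del: replicate_Suc)
  have e: "0 < e" "e \<le> 1 / 2" "2 * M * e \<le> norm (W p)"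
    using M by (auto simp: e_def field_simps min_def)
  have "A \<in> \<A>"
    unfolding A_def
    using e(1) fin_seq_in_c0[of "replicate (Suc p) 1"]
    by (intro x(2) openin_open_Int) (auto simp: y_def simp del: replicate_Suc)
  then have A: "A - {0..p} \<in> \<A>"
    by (rule \<A>)
  have near: "norm (apply_bcontfun y k - apply_bcontfun ((T ^^ n) x) k) < e" if "n \<in> A" for n k
    using that dist_bounded[of y k "(T ^^ n) x"] by (simp add: A_def dist_norm)
  have big: "1 / 2 < norm (apply_bcontfun ((T ^^ n) x) k)" if "n \<in> A" "k \<le> p" for n k
    using near[OF that(1), of k] that(2) e(2)
      norm_triangle_ineq2[of 1 "apply_bcontfun ((T ^^ n) x) k"] by (simp add: y)
  have small: "norm (apply_bcontfun ((T ^^ n) x) k) < e" if "n \<in> A" "p < k" for n k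
    using near[OF that(1), of k] that(2) by (simp add: y)
  have "filterlim (\<lambda>n. norm (\<Prod>i=1..n. w i)) at_top (inf sequentially (principal (A - {0..p})))"
    "\<And>n m. n \<in> A - {0..p} \<Longrightarrow> m \<in> A - {0..p} \<Longrightarrow> m < n \<Longrightarrow> M < norm (W (n - m + p))"
    by (rule weights_large_on_return_set[OF x(1) _ _ e(1,3)]; use big small in blast)+
  moreover have "A - {0..p} \<subseteq> {p..}"
    by auto
  ultimately show ?thesis
    using A by blast
qed

section \<open>Sufficiency\<close>

text \<open>
  Translates of a function supported in \<open>{0..p}\<close> by points more than \<open>p\<close> apart do not overlap, so
  their sum is at each place either 0 or a single value of that function.
\<close>
lemma sum_separated_translates:
  fixes g :: "nat \<Rightarrow> 'a"
  assumes sep: "\<And>n m. n \<in> B \<Longrightarrow> m \<in> B \<Longrightarrow> m < n \<Longrightarrow> m + p < n"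
    and g: "\<And>i. p < i \<Longrightarrow> g i = 0"
  shows "n \<in> B \<Longrightarrow> i \<le> p \<Longrightarrow> (\<Sum>m\<in>{m\<in>B. m \<le> n + i}. g (n + i - m)) = g i"
    and "(\<Sum>m\<in>{m\<in>B. m \<le> j}. g (j - m)) = 0 \<or>
      (\<exists>n\<in>B. \<exists>i\<le>p. j = n + i \<and> (\<Sum>m\<in>{m\<in>B. m \<le> j}. g (j - m)) = g i)"
proof -
  show main: "(\<Sum>m\<in>{m\<in>B. m \<le> n + i}. g (n + i - m)) = g i" if "n \<in> B" "i \<le> p" for n i
  proof -
    have "(\<Sum>m\<in>{m\<in>B. m \<le> n + i}. g (n + i - m)) = (\<Sum>m\<in>{n}. g (n + i - m))"
    proof (rule sum.mono_neutral_right)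
      show "\<forall>m\<in>{m\<in>B. m \<le> n + i} - {n}. g (n + i - m) = 0"
      proof
        fix m assume m: "m \<in> {m\<in>B. m \<le> n + i} - {n}"
        have "\<not> n < m"
          using sep[of m n] m that by auto
        then have "m + p < n"
          using sep[of n m] m that by auto
        then show "g (n + i - m) = 0"
          by (intro g) auto
      qed
    qed (use that in auto)
    then show ?thesis by simp
  qed
  show "(\<Sum>m\<in>{m\<in>B. m \<le> j}. g (j - m)) = 0 \<or>
      (\<exists>n\<in>B. \<exists>i\<le>p. j = n + i \<and> (\<Sum>m\<in>{m\<in>B. m \<le> j}. g (j - m)) = g i)"
  proof (cases "\<exists>n\<in>B. \<exists>i\<le>p. j = n + i")
    case True
    then show ?thesis
      using main by blast
  next
    case False
    have "g (j - m) = 0" if "m \<in> {m\<in>B. m \<le> j}" for m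
    proof (rule g, rule ccontr)
      assume "\<not> p < j - m"
      then have "j = m + (j - m)" "j - m \<le> p"
        using that by auto
      then show False
        using False that by blast
    qed
    then show ?thesis
      by (simp add: sum.neutral)
  qed
qed

text \<open>
  The vector is \<open>x = u + z\<close>, where \<open>W * z\<close> is the sum of the translates of \<open>g = W * y\<close> by the elements
  of \<open>B\<close>. At a time \<open>m\<close> in \<open>B\<close>, \<open>u\<close> has been shifted away, the translate by \<open>m\<close> has become \<open>y\<close> itself,
  and earlier translates have disappeared because the gaps in \<open>B\<close> exceed the length of \<open>y\<close>. What
  remains are the later translates, with coordinates of size at most \<open>C / norm (W (n - m + i))\<close>.
\<close>
lemma orbit_returning_along_separated_set:
  fixes u :: "nat \<Rightarrow>\<^sub>C 'a"
  assumes B: "\<And>n. n \<in> B \<Longrightarrow> length us \<le> n"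
    and sep: "\<And>n m. n \<in> B \<Longrightarrow> m \<in> B \<Longrightarrow> m < n \<Longrightarrow> m + length ys < n"
    and C: "\<And>i. norm (W i * apply_bcontfun (fin_seq ys) i) \<le> C"
    and lim: "\<And>Z. \<exists>N. \<forall>n\<in>B. \<forall>i\<le>length ys. N \<le> n \<longrightarrow> Z \<le> norm (W (n + i))"
    and near_u: "0 < r" "\<And>n i. n \<in> B \<Longrightarrow> i \<le> length ys \<Longrightarrow> C \<le> r * norm (W (n + i))"
    and near_y: "0 < s" "\<And>n m i. n \<in> B \<Longrightarrow> m \<in> B \<Longrightarrow> m < n \<Longrightarrow> i \<le> length ys \<Longrightarrow>
      C \<le> s * norm (W (n - m + i))"
  obtains x where "x \<in> c0" "dist (fin_seq us) x \<le> r"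
    "\<And>n. n \<in> B \<Longrightarrow> dist (fin_seq ys) ((T ^^ n) x) \<le> s"
proof -
  define g where "g i = W i * apply_bcontfun (fin_seq ys) i" for i
  define S where "S j = (\<Sum>m\<in>{m\<in>B. m \<le> j}. g (j - m))" for j
  have g0: "g i = 0" if "length ys < i" for i
    using that by (simp add: g_def apply_fin_seq)
  have S_block: "S (n + i) = g i" if "n \<in> B" "i \<le> length ys" for n i
    unfolding S_def by (rule sum_separated_translates(1)[OF _ _ that]) (use sep g0 in auto)
  have S_cases: "S j = 0 \<or> (\<exists>n\<in>B. \<exists>i\<le>length ys. j = n + i \<and> S j = g i)" for j
    unfolding S_def by (rule sum_separated_translates(2)) (use sep g0 in auto)
  have g_le: "norm (g i) \<le> C" for i
    unfolding g_def by (rule C)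
  have C0: "0 \<le> C"
    using order_trans[OF norm_ge_zero C] .
  have S_le: "norm (S j / W j) \<le> t"
    if t: "0 < t" and C_le: "\<And>n i. n \<in> B \<Longrightarrow> i \<le> length ys \<Longrightarrow> j = n + i \<Longrightarrow> C \<le> t * norm (W j)" for j t
    using S_cases[of j]
  proof
    assume "\<exists>n\<in>B. \<exists>i\<le>length ys. j = n + i \<and> S j = g i"
    then obtain i where "S j = g i" "C \<le> t * norm (W j)"
      using C_le by blast
    then have "norm (S j) \<le> t * norm (W j)"
      using g_le[of i] by simp
    then show ?thesis
      by (simp add: norm_divide divide_le_eq)
  qed (use t in simp)
  have "(\<lambda>j. S j / W j) \<longlonglongrightarrow> 0"
  proof (rule LIMSEQ_I)
    fix t :: real assume t: "0 < t"
    obtain N where N: "\<And>n i. n \<in> B \<Longrightarrow> i \<le> length ys \<Longrightarrow> N \<le> n \<Longrightarrow> C / (t / 2) \<le> norm (W (n + i))"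
      using lim[of "C / (t / 2)"] by blast
    have le: "norm (S j / W j) \<le> t / 2" if "N + length ys \<le> j" for j
    proof (rule S_le)
      fix n i assume "n \<in> B" "i \<le> length ys" "j = n + i"
      then have "C / (t / 2) \<le> norm (W j)"
        using N[of n i] that by simp
      then show "C \<le> t / 2 * norm (W j)"
        using t by (simp add: field_simps)
    qed (use t in simp)
    have "norm (S j / W j - 0) < t" if "N + length ys \<le> j" for j
      using le[OF that] t by simp
    then show "\<exists>no. \<forall>j\<ge>no. norm (S j / W j - 0) < t"
      by blast
  qed
  then obtain z where z: "z \<in> c0" "apply_bcontfun z = (\<lambda>j. S j / W j)"
    by (rule null_sequence_eq_c0)
  define x where "x = fin_seq us + z"
  have "x \<in> c0"
    unfolding x_def by (intro subspace_add subspace_c0 fin_seq_in_c0 z(1))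
  moreover have "dist (fin_seq us) x \<le> r"
  proof (rule dist_bound)
    fix j
    show "dist (apply_bcontfun (fin_seq us) j) (apply_bcontfun x j) \<le> r"
      using S_le[of r j] near_u by (simp add: x_def dist_norm z(2))
  qed
  moreover have "dist (fin_seq ys) ((T ^^ m) x) \<le> s" if m: "m \<in> B" for m
  proof (rule dist_bound)
    fix k
    have "apply_bcontfun (fin_seq us) (m + k) = 0"
      using B[OF m] by (simp add: apply_fin_seq)
    then have Wk: "W k * apply_bcontfun ((T ^^ m) x) k = S (m + k)"
      by (simp add: W_times_funpow_T x_def z(2))
    show "dist (apply_bcontfun (fin_seq ys) k) (apply_bcontfun ((T ^^ m) x) k) \<le> s"
    proof (cases "k \<le> length ys")
      case True
      then have "W k * apply_bcontfun ((T ^^ m) x) k = W k * apply_bcontfun (fin_seq ys) k"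
        using Wk S_block[OF m True] by (simp add: g_def)
      then show ?thesis
        using near_y(1) by simp
    next
      case False
      have "norm (W k * apply_bcontfun ((T ^^ m) x) k) \<le> s * norm (W k)"
        using S_cases[of "m + k"]
      proof
        assume "\<exists>n\<in>B. \<exists>i\<le>length ys. m + k = n + i \<and> S (m + k) = g i"
        then obtain n i where n: "n \<in> B" "i \<le> length ys" "m + k = n + i" "S (m + k) = g i"
          by blast
        then have "m < n" "k = n - m + i"
          using False by auto
        then have "C \<le> s * norm (W k)"
          using near_y(2)[of n m i] n m by simp
        then show ?thesis
          using g_le[of i] n(4) Wk by simp
      qed (use Wk near_y(1) in simp)
      then have "norm (apply_bcontfun ((T ^^ m) x) k) \<le> s"
        by (simp add: norm_mult mult.commute[of s])
      then show ?thesis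
        using False by (simp add: apply_fin_seq dist_norm)
    qed
  qed
  ultimately show thesis
    by (rule that)
qed

text \<open>
  As \<open>M\<close> dominates \<open>norm (W d)\<close> for all \<open>d \<le> 2 * p\<close>, a value \<open>norm (W (d + p))\<close> can exceed \<open>M\<close> only
  if \<open>d > p\<close>.
\<close>
lemma separated_of_large_weights:
  assumes "\<And>n m. n \<in> A \<Longrightarrow> m \<in> A \<Longrightarrow> m < n \<Longrightarrow> M < norm (W (n - m + p))"
    and "(\<Sum>d\<le>2 * p. norm (W d)) \<le> M"
    and "n \<in> A" "m \<in> A" "m < n"
  shows "m + p < n"
proof (rule ccontr)
  assume "\<not> m + p < n"
  then have "norm (W (n - m + p)) \<le> (\<Sum>d\<le>2 * p. norm (W d))"
    by (intro member_le_sum) auto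
  then show False
    using assms by fastforce
qed

text \<open>
  The single set \<open>A'\<close>, and with it \<open>\<delta>\<close>, is fixed by the centre and the radius of the target ball; an
  open set \<open>U\<close> only determines how long an initial piece of \<open>A'\<close> has to be discarded.
\<close>
lemma return_sets_into_ball:
  assumes \<A>: "upper_representation \<A> D I \<F>" "finitely_invariant_representation \<A> D I \<F>"
    and large: "\<And>p M. (M::real) > 0 \<Longrightarrow> \<exists>A\<in>\<A>. A \<subseteq> {p..} \<and>
        filterlim (\<lambda>n. norm (\<Prod>i=1..n. w i)) at_top (inf sequentially (principal A)) \<and>
        (\<forall>n\<in>A. \<forall>m\<in>A. n > m \<longrightarrow> norm (W (n - m + p)) > M)"
    and r: "0 < r"
  shows "\<exists>\<delta>\<in>D. \<forall>U. openin (top_of_set c0) U \<and> U \<noteq> {} \<longrightarrow>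
    (\<exists>x\<in>U. {n. (T ^^ n) x \<in> c0 \<inter> ball (fin_seq ys) r} \<in> (\<Inter>\<mu>\<in>I. \<F> \<delta> \<mu>))"
proof -
  define p where "p = length ys"
  obtain K where K: "0 < K" "\<And>n i. i \<le> p \<Longrightarrow> norm (W (n + p)) \<le> K * norm (W (n + i))"
    using W_le_within_block[of p] by metis
  define C where "C = (\<Sum>i\<le>p. norm (W i * apply_bcontfun (fin_seq ys) i))"
  have C: "norm (W i * apply_bcontfun (fin_seq ys) i) \<le> C" for i
  proof (cases "i \<le> p")
    case True
    then show ?thesis
      unfolding C_def by (intro member_le_sum) auto
  next
    case False
    then show ?thesis
      by (auto simp: apply_fin_seq p_def C_def intro: sum_nonneg)
  qed
  define s where "s = r / 2"
  have s: "0 < s" "s < r"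
    using r by (auto simp: s_def)
  \<comment> \<open>\<open>K * C / s\<close> makes later copies of \<open>y\<close> smaller than \<open>s\<close>; the sum forces gaps longer than \<open>p\<close>\<close>
  define M where "M = max 1 (max (K * C / s) (\<Sum>d\<le>2 * p. norm (W d)))"
  have M: "0 < M"
    by (simp add: M_def)
  obtain A where A: "A \<in> \<A>" "A \<subseteq> {p..}"
    "filterlim (\<lambda>n. norm (\<Prod>i=1..n. w i)) at_top (inf sequentially (principal A))"
    "\<And>n m. n \<in> A \<Longrightarrow> m \<in> A \<Longrightarrow> m < n \<Longrightarrow> M < norm (W (n - m + p))"
    using large[OF M, of p] by blast
  define A' where "A' = left_shift A p"
  have A'_iff: "n \<in> A' \<longleftrightarrow> n + p \<in> A" for n
    using A(2) by (force simp: A'_def left_shift_def)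
  have A'_diff: "M < norm (W (n - m + p))" if "n \<in> A'" "m \<in> A'" "m < n" for n m
    using A(4)[of "n + p" "m + p"] that by (simp add: A'_iff)
  have sep: "m + p < n" if "n \<in> A'" "m \<in> A'" "m < n" for n m
    by (rule separated_of_large_weights[OF A'_diff]) (use that in \<open>auto simp: M_def\<close>)
  have near_y: "C \<le> s * norm (W (n - m + i))" if "n \<in> A'" "m \<in> A'" "m < n" "i \<le> p" for n m i
  proof -
    have "K * C / s \<le> norm (W (n - m + p))"
      using A'_diff[OF that(1-3)] by (simp add: M_def)
    also have "\<dots> \<le> K * norm (W (n - m + i))"
      using K(2) that(4) .
    finally have "K * C \<le> K * (s * norm (W (n - m + i)))"
      using s(1) by (simp add: field_simps)
    then show ?thesis
      using K(1) by simp
  qed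
  have lim: "\<exists>N. \<forall>n\<in>A'. \<forall>i\<le>p. N \<le> n \<longrightarrow> Z \<le> norm (W (n + i))" for Z
  proof -
    obtain N where N: "\<And>n. n \<in> A \<Longrightarrow> N \<le> n \<Longrightarrow> K * Z \<le> norm (W n)"
      using A(3) unfolding filterlim_norm_W_iff by blast
    have "Z \<le> norm (W (n + i))" if "n \<in> A'" "i \<le> p" "N \<le> n" for n i
    proof -
      have "K * Z \<le> K * norm (W (n + i))"
        using N[of "n + p"] K(2)[OF that(2), of n] that by (simp add: A'_iff)
      then show ?thesis
        using K(1) by simp
    qed
    then show ?thesis by blast
  qed
  have "A' \<in> \<A>"
  proof -
    obtain \<delta> where "\<delta> \<in> D" "left_shift A p \<in> (\<Inter>\<mu>\<in>I. \<F> \<delta> \<mu>)"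
      using A(1) \<A>(1) unfolding upper_representation_def by meson
    then show ?thesis
      unfolding A'_def by (rule upper_representation_member[OF \<A>(1)])
  qed
  then obtain \<delta> where \<delta>: "\<delta> \<in> D" "\<And>n. A' - {0..n} \<in> (\<Inter>\<mu>\<in>I. \<F> \<delta> \<mu>)"
    using \<A>(2) unfolding finitely_invariant_representation_def by meson
  have "\<exists>x\<in>U. {n. (T ^^ n) x \<in> c0 \<inter> ball (fin_seq ys) r} \<in> (\<Inter>\<mu>\<in>I. \<F> \<delta> \<mu>)"
    if U: "openin (top_of_set c0) U" "U \<noteq> {}" for U
  proof -
    obtain v where v: "v \<in> U" "v \<in> c0"
      using U openin_imp_subset by blast
    obtain e where e: "0 < e" "ball v e \<inter> c0 \<subseteq> U"
      using U(1) v(1) unfolding openin_contains_ball by blast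
    obtain us where us: "dist v (fin_seq us) < e / 2"
      using fin_seq_dense_in_c0[OF v(2), of "e / 2" UNIV] e(1) by auto
    define t where "t = e / 2"
    have t: "0 < t"
      using e(1) by (simp add: t_def)
    obtain N where N: "\<And>n i. n \<in> A' \<Longrightarrow> i \<le> p \<Longrightarrow> N \<le> n \<Longrightarrow> C / t \<le> norm (W (n + i))"
      using lim[of "C / t"] by blast
    define B where "B = A' - {0..N + length us}"
    have sub: "n \<in> A' \<and> N \<le> n \<and> length us \<le> n" if "n \<in> B" for n
      using that by (auto simp: B_def)
    obtain x where x: "x \<in> c0" "dist (fin_seq us) x \<le> t"
      "\<And>n. n \<in> B \<Longrightarrow> dist (fin_seq ys) ((T ^^ n) x) \<le> s"
    proof (rule orbit_returning_along_separated_set[of B us ys C t s])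
      show "\<exists>N. \<forall>n\<in>B. \<forall>i\<le>length ys. N \<le> n \<longrightarrow> Z \<le> norm (W (n + i))" for Z
        using lim[of Z] sub unfolding p_def by blast
      show "C \<le> t * norm (W (n + i))" if "n \<in> B" "i \<le> length ys" for n i
        using N[of n i] sub[OF that(1)] that(2) t by (simp add: p_def field_simps)
    qed (use sub sep near_y C s t in \<open>auto simp: p_def\<close>)
    have "dist v x < e"
      using dist_triangle[of v x "fin_seq us"] us x(2) by (simp add: t_def)
    then have "x \<in> U"
      using e(2) x(1) by auto
    have c0: "(T ^^ n) x \<in> c0" for n
      using continuous_map_funspace[OF continuous_map_funpow[OF continuous_map_T, of n]] x(1) by auto
    have sub_ret: "B \<subseteq> {n. (T ^^ n) x \<in> c0 \<inter> ball (fin_seq ys) r}"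
      using x(3) s(2) c0 by force
    have "{n. (T ^^ n) x \<in> c0 \<inter> ball (fin_seq ys) r} \<in> \<F> \<delta> \<mu>" if "\<mu> \<in> I" for \<mu>
    proof (rule finitely_hereditary_upward_mono[OF _ _ sub_ret])
      show "finitely_hereditary_upward (\<F> \<delta> \<mu>)"
        using \<A>(1) \<delta>(1) that by (auto simp: upper_representation_def)
      show "B \<in> \<F> \<delta> \<mu>"
        using \<delta>(2) that by (auto simp: B_def)
    qed
    then show ?thesis
      using \<open>x \<in> U\<close> by blast
  qed
  then show ?thesis
    using \<delta>(1) by blast
qed

end

theorem corollary30:
  fixes w :: "nat \<Rightarrow> 'a :: {real_normed_field, euclidean_space}"
    and \<A> :: "nat set set"
  assumes "bounded (w ` {1..})"
    and "\<forall>n\<ge>1. w n \<noteq> 0"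
    and "ufi_upper_furstenberg_family \<A>"
  shows "family_hypercyclic \<A> (top_of_set c0) (weighted_backward_shift w) \<longleftrightarrow>
    (\<forall>(p::nat) (M::real). M > 0 \<longrightarrow>
      (\<exists>A\<in>\<A>. A \<subseteq> {p..} \<and>
        filterlim (\<lambda>n. norm (\<Prod>i=1..n. w i)) at_top (inf sequentially (principal A)) \<and>
        (\<forall>n\<in>A. \<forall>m\<in>A. n > m \<longrightarrow> norm (\<Prod>i=1..n - m + p. w i) > M)))"
proof -
  interpret weight_sequence w
    using assms(1,2) by unfold_locales
  obtain D :: "nat set set set" and I :: "nat set" and \<F> where
    \<A>: "furstenberg_family \<A>" "upper_representation \<A> D I \<F>"
      "finitely_invariant_representation \<A> D I \<F>"
    using assms(3) unfolding ufi_upper_furstenberg_family_def by blast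
  have inv: "A - {0..n} \<in> \<A>" if "A \<in> \<A>" for A n
  proof -
    obtain \<delta> where "\<delta> \<in> D" "A - {0..n} \<in> (\<Inter>\<mu>\<in>I. \<F> \<delta> \<mu>)"
      using \<A>(3) \<open>A \<in> \<A>\<close> unfolding finitely_invariant_representation_def by meson
    then show ?thesis
      by (rule upper_representation_member[OF \<A>(2)])
  qed
  show ?thesis
  proof (intro iffI allI impI)
    fix p :: nat and M :: real
    assume "family_hypercyclic \<A> (top_of_set c0) (weighted_backward_shift w)" and "M > 0"
    then show "\<exists>A\<in>\<A>. A \<subseteq> {p..} \<and>
        filterlim (\<lambda>n. norm (\<Prod>i=1..n. w i)) at_top (inf sequentially (principal A)) \<and>
        (\<forall>n\<in>A. \<forall>m\<in>A. n > m \<longrightarrow> norm (\<Prod>i=1..n - m + p. w i) > M)"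
      using large_weights_of_family_hypercyclic[OF inv] unfolding W_def by blast
  next
    assume large: "\<forall>(p::nat) (M::real). M > 0 \<longrightarrow>
      (\<exists>A\<in>\<A>. A \<subseteq> {p..} \<and>
        filterlim (\<lambda>n. norm (\<Prod>i=1..n. w i)) at_top (inf sequentially (principal A)) \<and>
        (\<forall>n\<in>A. \<forall>m\<in>A. n > m \<longrightarrow> norm (\<Prod>i=1..n - m + p. w i) > M))"
    obtain \<V> :: "(nat \<Rightarrow>\<^sub>C 'a) set set" where \<V>: "countable \<V>"
      "\<And>V. V \<in> \<V> \<Longrightarrow> \<exists>ys r. 0 < r \<and> V = c0 \<inter> ball (fin_seq ys) r"
      "\<And>U. openin (top_of_set c0) U \<Longrightarrow> U \<noteq> {} \<Longrightarrow> \<exists>V\<in>\<V>. V \<subseteq> U"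
      using c0_countable_pi_base by blast
    show "family_hypercyclic \<A> (top_of_set c0) (weighted_backward_shift w)"
    proof (rule family_hypercyclic_of_dense_return_sets[OF _ _ continuous_map_T \<A>(1,2) \<V>(1)])
      show "completely_metrizable_space (top_of_set (c0 :: (nat \<Rightarrow>\<^sub>C 'a) set))"
        by (rule completely_metrizable_c0)
      show "topspace (top_of_set (c0 :: (nat \<Rightarrow>\<^sub>C 'a) set)) \<noteq> {}"
        using fin_seq_in_c0 by auto
      show "openin (top_of_set c0) V" if "V \<in> \<V>" for V
        using \<V>(2)[OF that] by (auto intro: openin_open_Int)
      show "\<exists>V\<in>\<V>. V \<subseteq> U" if "openin (top_of_set c0) U" "U \<noteq> {}" for U
        using \<V>(3)[OF that] .
      fix V assume "V \<in> \<V>"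
      then obtain ys r where "0 < r" and V: "V = c0 \<inter> ball (fin_seq ys) r"
        using \<V>(2) by blast
      then show "\<exists>\<delta>\<in>D. \<forall>U. openin (top_of_set c0) U \<and> U \<noteq> {} \<longrightarrow>
          (\<exists>x\<in>U. {n. (weighted_backward_shift w ^^ n) x \<in> V} \<in> (\<Inter>\<mu>\<in>I. \<F> \<delta> \<mu>))"
        unfolding V
        by (intro return_sets_into_ball[OF \<A>(2,3)]) (use large in \<open>simp_all add: W_def\<close>)
    qed
  qed
qed

end
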